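(* Let $n$ be the number of missionaries and also the number of cannibals, and let $b$ be the maximal number of people the boat can carry. Suppose that $n$ is equal to $4$ or $5$ and $b=2$, or that $n\ge 6$ and $b=3$. Then the missionaries and cannibals problem (MC) has no solution.
   Context: MC problem with $n$ missionaries, $n$ cannibals and a boat of capacity $b$. A pair $(c,m)$ ($c$ cannibals, $m$ missionaries) of nonnegative integers is safe if $m=0$ or $c\le m$. A state is a triple $((c,m),(n-c,n-m),loc)$ with $0\le c,m\le n$ and $loc\in\{left,right\}$ (people on the left bank, people on the right bank, boat's location); it is admissible if both pairs are safe. Only admissible states are considered. A transition $(L_1',R_1',loc_1)\to(L_2',R_2',loc_2)$ between admissible states means: $loc_2\neq loc_1$ and there is a safe pair $B'=(c,m)$ (the people in the boat) with $0<c+m\le b$ such that $L_2'=L_1'-B'$, $R_2'=R_1'+B'$ (componentwise) if $loc_1=left$, while $R_2'=R_1'-B'$, $L_2'=L_1'+B'$ if $loc_1=right$. A solution of MC is a finite sequence of admissible states, consecutive ones joined by transitions, from the initial state $((n,n),(0,0),left)$ to the final state $((0,0),(n,n),right)$. *)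

theory Defs
  imports Main "HOL-Library.Product_Plus"
begin

(* Pairs are (cannibals, missionaries); addition and subtraction of pairs are componentwise. *)
type_synonym people = "nat \<times> nat"

datatype location = LeftBank | RightBank

(* (people on the left bank, people on the right bank, location of the boat) *)
type_synonym state = "people \<times> people \<times> location"

definition safe :: "people \<Rightarrow> bool" where
  "safe p \<longleftrightarrow> (case p of (c, m) \<Rightarrow> m = 0 \<or> c \<le> m)"

definition is_state :: "nat \<Rightarrow> state \<Rightarrow> bool" where
  "is_state n s \<longleftrightarrow>
     (\<exists>c m loc. c \<le> n \<and> m \<le> n \<and> s = ((c, m), (n - c, n - m), loc))"

definition admissible :: "nat \<Rightarrow> state \<Rightarrow> bool" where
  "admissible n s \<longleftrightarrow>
     is_state n s \<and> (case s of (L, R, loc) \<Rightarrow> safe L \<and> safe R)"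

(* Subtraction on nat truncates, so the equation L2 = L1 - B over the integers is
   written as L1 = L2 + B, which also forces B to be available on the departure bank. *)
definition transition :: "nat \<Rightarrow> nat \<Rightarrow> state \<Rightarrow> state \<Rightarrow> bool" where
  "transition n b s1 s2 \<longleftrightarrow>
     admissible n s1 \<and> admissible n s2 \<and>
     (case (s1, s2) of ((L1, R1, loc1), (L2, R2, loc2)) \<Rightarrow>
        loc2 \<noteq> loc1 \<and>
        (\<exists>c m. safe (c, m) \<and> 0 < c + m \<and> c + m \<le> b \<and>
           (case loc1 of
              LeftBank \<Rightarrow> L1 = L2 + (c, m) \<and> R2 = R1 + (c, m)
            | RightBank \<Rightarrow> R1 = R2 + (c, m) \<and> L2 = L1 + (c, m))))"

definition initial_state :: "nat \<Rightarrow> state" where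
  "initial_state n = ((n, n), (0, 0), LeftBank)"

definition final_state :: "nat \<Rightarrow> state" where
  "final_state n = ((0, 0), (n, n), RightBank)"

definition mc_solution :: "nat \<Rightarrow> nat \<Rightarrow> state list \<Rightarrow> bool" where
  "mc_solution n b ss \<longleftrightarrow>
     ss \<noteq> [] \<and> (\<forall>s \<in> set ss. admissible n s) \<and>
     hd ss = initial_state n \<and> last ss = final_state n \<and>
     (\<forall>i. Suc i < length ss \<longrightarrow> transition n b (ss ! i) (ss ! Suc i))"

end

theory Submission
  imports Defs
begin

text \<open>
  Look at the left bank, holding \<open>c\<close> cannibals and \<open>m\<close> missionaries. Safety of both banks forces
  \<open>m = n\<close>, \<open>m = 0\<close> or \<open>c = m\<close>. If \<open>n \<ge> 2b\<close>, no crossing leads directly from \<open>m = n\<close> to \<open>m = 0\<close>,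
  so the diagonal \<open>c = m\<close> has to be traversed. It is entered with \<open>m \<ge> n - b\<close> and the boat on the
  right, and as \<open>b \<le> 3\<close>, one crossing moves only a single step along it; hence the boat oscillates
  there and never gets to carry away the remaining missionaries.
\<close>

text \<open>The bounds differ by one: between diagonal states, leaving the left bank lowers
  \<open>m\<close> by exactly one and returning raises it.\<close>

definition trapped :: "nat \<Rightarrow> nat \<Rightarrow> state \<Rightarrow> bool" where
  "trapped n b s \<longleftrightarrow>
     (case s of ((c, m), _, loc) \<Rightarrow>
        m = n \<or> c = m \<and> (case loc of LeftBank \<Rightarrow> n < m + b | RightBank \<Rightarrow> n \<le> m + b))"

text \<open>For \<open>0 < m < n\<close>, the left bank needs \<open>c \<le> m\<close> and the right
  bank \<open>n - c \<le> n - m\<close>.\<close>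

lemma admissible_iff:
  "admissible n ((c, m), R, loc) \<longleftrightarrow>
     c \<le> n \<and> m \<le> n \<and> R = (n - c, n - m) \<and> (m = 0 \<or> m = n \<or> c = m)"
  by (auto simp: admissible_def is_state_def safe_def)

lemma trapped_transition:
  assumes "b \<le> 3" "2 * b \<le> n" "transition n b s t" "trapped n b s"
  shows "trapped n b t"
proof -
  obtain c m R loc c' m' R' loc' where s: "s = ((c, m), R, loc)" and t: "t = ((c', m'), R', loc')"
    by (metis prod.exhaust)
  have adm: "c \<le> n" "m \<le> n" "R = (n - c, n - m)" "c' \<le> n" "m' \<le> n" "R' = (n - c', n - m')"
    "m' = 0 \<or> m' = n \<or> c' = m'"
    using assms(3) by (auto simp: transition_def s t admissible_iff)
  show ?thesis
  proof (cases loc)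
    case LeftBank
    then obtain x y where "0 < x + y" "x + y \<le> b" "c = c' + x" "m = m' + y" "loc' = RightBank"
      using assms(3) by (cases loc') (auto simp: transition_def s t)
    \<comment> \<open>\<open>m' = 0\<close> would require \<open>y = m > b\<close>. Staying on the
      diagonal means \<open>x = y\<close>, so \<open>x + y \<le> 3\<close> leaves only
      \<open>x = y = 1\<close>.\<close>
    with adm assms(1,2,4) LeftBank show ?thesis
      by (auto simp: trapped_def s t)
  next
    case RightBank
    then obtain x y where "0 < x + y" "x + y \<le> b" "n - c = n - c' + x" "n - m = n - m' + y"
      "loc' = LeftBank"
      using assms(3) adm by (cases loc') (auto simp: transition_def s t)
    moreover from this have "c' = c + x" "m' = m + y"
      using adm by linarith+
    ultimately show ?thesis
      using adm assms(1,2,4) RightBank by (auto simp: trapped_def s t)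
  qed
qed

theorem mainTheorem4:
  fixes n b :: nat
  assumes "((n = 4 \<or> n = 5) \<and> b = 2) \<or> (n \<ge> 6 \<and> b = 3)"
  shows "\<not> (\<exists>ss. mc_solution n b ss)"
proof
  assume "\<exists>ss. mc_solution n b ss"
  then obtain ss where ss: "ss \<noteq> []" "hd ss = initial_state n" "last ss = final_state n"
    and step: "\<And>i. Suc i < length ss \<Longrightarrow> transition n b (ss ! i) (ss ! Suc i)"
    by (auto simp: mc_solution_def)
  have b: "b \<le> 3" "2 * b \<le> n" "b < n"
    using assms by auto
  have "trapped n b (ss ! i)" if "i < length ss" for i
    using that
  proof (induction i)
    case 0
    with ss show ?case
      by (simp add: hd_conv_nth[symmetric] initial_state_def trapped_def)
  next
    case (Suc i)
    with trapped_transition[OF b(1,2) step] show ?case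
      by simp
  qed
  then have "trapped n b (final_state n)"
    using ss by (metis last_conv_nth diff_less length_greater_0_conv zero_less_one)
  \<comment> \<open>Here \<open>m = 0\<close> with the boat on the right, so \<open>trapped\<close>
    would give \<open>n = 0\<close> or \<open>n \<le> b\<close>.\<close>
  with b show False
    by (simp add: trapped_def final_state_def)
qed

end
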